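(* (i) If $\mathbf P=(P,\le,{}',0,1)$ is a finite Boolean poset, then $\mathbb B(\mathbb D(\mathbf P))=\mathbf P$. (ii) If $\mathbf D=(P,+,\cdot,0,1)$ is a finite dual of a Boolean poset and $\mathbb D(\mathbb B(\mathbf D))=(P,\oplus,\odot,0,1)$, then $A\odot B=A\cdot B$ for all subsets $A,B\subseteq P$ (in particular for all elements), i.e. $(P,\odot,0,1)=(P,\cdot,0,1)$.
   Context: For a poset and $X\subseteq P$: $L(X)$, $U(X)$ are the sets of lower/upper bounds; $\operatorname{Max}$, $\operatorname{Min}$ the sets of maximal/minimal elements; $L(x,y)=L(\{x,y\})$, $LU(X)=L(U(X))$. A complemented poset is a bounded poset $(P,\le,{}',0,1)$ with an antitone involution $'$ such that $L(x,x')=\{0\}$, $U(x,x')=\{1\}$. A poset is distributive if $L(U(x,y),z)=LU(L(x,z),L(y,z))$ for all $x,y,z$; a Boolean poset is a distributive complemented poset. A dual of a Boolean poset is a structure $(P,+,\cdot,0,1)$ where $+,\cdot$ are binary operators on $P$ (defined on pairs of elements and of subsets, with values subsets of $P$; elements identified with singletons), $0,1\in P$, such that for all $x,y,z\in P$ and $A,B\subseteq P$: (i) $x\cdot x=x$, $x\cdot y=y\cdot x$, $x\cdot0=0$, $x\cdot1=x$, $(x\cdot(y\cdot z))\cdot z=(x\cdot(y\cdot z))\cdot1$; (ii) $(x+1)+1=x$; (iii) $x\cdot y=x$ implies $(x+1)\cdot(y+1)=y+1$; (iv) $x\cdot(x+1)=0$; (v) $\big(((x+1)\cdot(y+1))+1\big)\cdot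 z=\big((((x\cdot z)+1)\cdot((y\cdot z)+1))+1\big)\cdot1$; (vi) $x\in A\cdot B$ iff [$x\cdot y=x$ for all $y\in A\cup B$, and every $z$ with $x\cdot z=x$ and $z\cdot y=z$ for all $y\in A\cup B$ satisfies $z=x$]. For a finite Boolean poset $\mathbf P=(P,\le,{}',0,1)$, $\mathbb D(\mathbf P):=(P,+,\cdot,0,1)$ with $A+B:=\operatorname{Min}U\big(\operatorname{Max}L(A'\cup B)\cup\operatorname{Max}L(A\cup B')\big)$ and $A\cdot B:=\operatorname{Max}L(A\cup B)$ for subsets $A,B$ (where $A'=\{a'\mid a\in A\}$); this is a dual of a Boolean poset. For a finite dual $\mathbf D=(P,+,\cdot,0,1)$ of a Boolean poset, $\mathbb B(\mathbf D):=(P,\le,{}',0,1)$ with $x\le y$ iff $x\cdot y=x$ and $x':=x+1$; this is a Boolean poset. *)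

theory Defs
  imports "HOL-Library.FuncSet"
begin

record 'a bounded_carrier =
  carrier :: "'a set"
  zero :: 'a  (\<open>\<zero>\<index>\<close>)
  one :: 'a  (\<open>\<one>\<index>\<close>)

text \<open>
  Structures are compared by equality of records, so every component is normalised: orders are
  subsets of \<open>carrier \<times> carrier\<close> and functions are extensional outside their domain.
\<close>

record 'a poset_struct = "'a bounded_carrier" +
  ord :: "'a rel"
  cmpl :: "'a \<Rightarrow> 'a"

abbreviation le :: "('a, 'b) poset_struct_scheme \<Rightarrow> 'a \<Rightarrow> 'a \<Rightarrow> bool"  (infix \<open>\<preceq>\<index>\<close> 50)
  where "x \<preceq>\<^bsub>P\<^esub> y \<equiv> (x, y) \<in> ord P"

definition lower :: "('a, 'b) poset_struct_scheme \<Rightarrow> 'a set \<Rightarrow> 'a set"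
  where "lower P X = {a \<in> carrier P. \<forall>x\<in>X. a \<preceq>\<^bsub>P\<^esub> x}"

definition upper :: "('a, 'b) poset_struct_scheme \<Rightarrow> 'a set \<Rightarrow> 'a set"
  where "upper P X = {a \<in> carrier P. \<forall>x\<in>X. x \<preceq>\<^bsub>P\<^esub> a}"

definition maximals :: "('a, 'b) poset_struct_scheme \<Rightarrow> 'a set \<Rightarrow> 'a set"
  where "maximals P X = {x \<in> X. \<forall>y\<in>X. x \<preceq>\<^bsub>P\<^esub> y \<longrightarrow> y = x}"

definition minimals :: "('a, 'b) poset_struct_scheme \<Rightarrow> 'a set \<Rightarrow> 'a set"
  where "minimals P X = {x \<in> X. \<forall>y\<in>X. y \<preceq>\<^bsub>P\<^esub> x \<longrightarrow> y = x}"

locale complemented_poset =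
  fixes P :: "('a, 'b) poset_struct_scheme" (structure)
  assumes partial_order: "partial_order_on (carrier P) (ord P)"
    and zero_closed: "\<zero> \<in> carrier P"
    and one_closed: "\<one> \<in> carrier P"
    and zero_least: "x \<in> carrier P \<Longrightarrow> \<zero> \<preceq> x"
    and one_greatest: "x \<in> carrier P \<Longrightarrow> x \<preceq> \<one>"
    and cmpl_fun: "cmpl P \<in> carrier P \<rightarrow>\<^sub>E carrier P"
    and cmpl_antitone:
      "\<lbrakk>x \<in> carrier P; y \<in> carrier P; x \<preceq> y\<rbrakk> \<Longrightarrow> cmpl P y \<preceq> cmpl P x"
    and cmpl_involution: "x \<in> carrier P \<Longrightarrow> cmpl P (cmpl P x) = x"
    and lower_cmpl: "x \<in> carrier P \<Longrightarrow> lower P {x, cmpl P x} = {\<zero>}"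
    and upper_cmpl: "x \<in> carrier P \<Longrightarrow> upper P {x, cmpl P x} = {\<one>}"

locale boolean_poset = complemented_poset +
  assumes distributive:
    "\<lbrakk>x \<in> carrier P; y \<in> carrier P; z \<in> carrier P\<rbrakk> \<Longrightarrow>
      lower P (upper P {x, y} \<union> {z}) = lower P (upper P (lower P {x, z} \<union> lower P {y, z}))"

text \<open>
  The operators of a dual act on subsets of the carrier; an element \<open>x\<close> is passed as \<open>{x}\<close>.
\<close>

record 'a dual_struct = "'a bounded_carrier" +
  add :: "'a set \<Rightarrow> 'a set \<Rightarrow> 'a set"  (infixl \<open>\<oplus>\<index>\<close> 65)
  mult :: "'a set \<Rightarrow> 'a set \<Rightarrow> 'a set"  (infixl \<open>\<odot>\<index>\<close> 70)

locale boolean_dual =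
  fixes D :: "('a, 'b) dual_struct_scheme" (structure)
  assumes add_fun: "add D \<in> Pow (carrier D) \<rightarrow>\<^sub>E Pow (carrier D) \<rightarrow>\<^sub>E Pow (carrier D)"
    and mult_fun: "mult D \<in> Pow (carrier D) \<rightarrow>\<^sub>E Pow (carrier D) \<rightarrow>\<^sub>E Pow (carrier D)"
    and zero_closed: "\<zero> \<in> carrier D"
    and one_closed: "\<one> \<in> carrier D"
    and mult_idem: "x \<in> carrier D \<Longrightarrow> {x} \<odot> {x} = {x}"
    and mult_comm: "\<lbrakk>x \<in> carrier D; y \<in> carrier D\<rbrakk> \<Longrightarrow> {x} \<odot> {y} = {y} \<odot> {x}"
    and mult_zero: "x \<in> carrier D \<Longrightarrow> {x} \<odot> {\<zero>} = {\<zero>}"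
    and mult_one: "x \<in> carrier D \<Longrightarrow> {x} \<odot> {\<one>} = {x}"
    and mult_absorb: "\<lbrakk>x \<in> carrier D; y \<in> carrier D; z \<in> carrier D\<rbrakk> \<Longrightarrow>
      ({x} \<odot> ({y} \<odot> {z})) \<odot> {z} = ({x} \<odot> ({y} \<odot> {z})) \<odot> {\<one>}"
    and add_one_add_one: "x \<in> carrier D \<Longrightarrow> ({x} \<oplus> {\<one>}) \<oplus> {\<one>} = {x}"
    and add_one_antitone: "\<lbrakk>x \<in> carrier D; y \<in> carrier D; {x} \<odot> {y} = {x}\<rbrakk> \<Longrightarrow>
      ({x} \<oplus> {\<one>}) \<odot> ({y} \<oplus> {\<one>}) = {y} \<oplus> {\<one>}"
    and mult_add_one: "x \<in> carrier D \<Longrightarrow> {x} \<odot> ({x} \<oplus> {\<one>}) = {\<zero>}"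
    and distributive: "\<lbrakk>x \<in> carrier D; y \<in> carrier D; z \<in> carrier D\<rbrakk> \<Longrightarrow>
      ((({x} \<oplus> {\<one>}) \<odot> ({y} \<oplus> {\<one>})) \<oplus> {\<one>}) \<odot> {z} =
      (((({x} \<odot> {z}) \<oplus> {\<one>}) \<odot> (({y} \<odot> {z}) \<oplus> {\<one>})) \<oplus> {\<one>}) \<odot> {\<one>}"
    and mem_mult_iff: "\<lbrakk>A \<subseteq> carrier D; B \<subseteq> carrier D; x \<in> carrier D\<rbrakk> \<Longrightarrow>
      x \<in> A \<odot> B \<longleftrightarrow>
        (\<forall>y \<in> A \<union> B. {x} \<odot> {y} = {x}) \<and>
        (\<forall>z \<in> carrier D. {x} \<odot> {z} = {x} \<and> (\<forall>y \<in> A \<union> B. {z} \<odot> {y} = {z}) \<longrightarrow> z = x)"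

definition dual_of :: "'a poset_struct \<Rightarrow> 'a dual_struct"  (\<open>\<bbbD>\<close>)
  where "\<bbbD> P = \<lparr>
    carrier = carrier P, zero = zero P, one = one P,
    add = (\<lambda>A \<in> Pow (carrier P). \<lambda>B \<in> Pow (carrier P).
      minimals P (upper P
        (maximals P (lower P (cmpl P ` A \<union> B)) \<union> maximals P (lower P (A \<union> cmpl P ` B))))),
    mult = (\<lambda>A \<in> Pow (carrier P). \<lambda>B \<in> Pow (carrier P). maximals P (lower P (A \<union> B)))\<rparr>"

text \<open>
  In a dual of a Boolean poset every \<open>x + 1\<close> is a singleton, so \<open>the_elem\<close> below returns it:
  \<open>add_one_antitone\<close> with \<open>y = x\<close> gives \<open>A \<cdot> A = A\<close> for \<open>A = x + 1\<close>, and by \<open>mem_mult_iff\<close>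
  every element of \<open>A \<cdot> A\<close> lies below every element of \<open>A\<close>, while the product of the empty set
  with itself contains \<open>1\<close>.
\<close>

definition poset_of :: "'a dual_struct \<Rightarrow> 'a poset_struct"  (\<open>\<bbbB>\<close>)
  where "\<bbbB> D = \<lparr>
    carrier = carrier D, zero = zero D, one = one D,
    ord = {(x, y). x \<in> carrier D \<and> y \<in> carrier D \<and> {x} \<odot>\<^bsub>D\<^esub> {y} = {x}},
    cmpl = (\<lambda>x \<in> carrier D. the_elem ({x} \<oplus>\<^bsub>D\<^esub> {\<one>\<^bsub>D\<^esub>}))\<rparr>"

end

theory Submission
  imports Defs
begin

text \<open>Each structure is determined by what the other one remembers of it. In
  \<open>\<bbbD> P\<close> the product of x and y is Max L(x,y), which equals {x} exactly when x
  lies below y (\<open>maximals_lower_pair_eq_iff\<close>), so the order is recovered. The sum x + 1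
  is Min U of {x'} and {0}, because 1' = 0, hence it is {x'}
  (\<open>symmetric_difference_one\<close>), and the complement is recovered. Conversely, the axiom
  \<open>mem_mult_iff\<close> of a dual, read in the order "x times y is x", says that the product
  of A and B consists of the maximal common lower bounds of A and B
  (\<open>maximals_lower_poset_of\<close>). This is how \<open>\<bbbD>\<close> defines the
  product.\<close>

context complemented_poset
begin

lemma le_carrier: "x \<preceq> y \<Longrightarrow> x \<in> carrier P \<and> y \<in> carrier P"
  using partial_order by (auto simp: partial_order_on_def preorder_on_def)

lemma le_refl: "x \<in> carrier P \<Longrightarrow> x \<preceq> x"
  using partial_order by (auto simp: partial_order_on_def preorder_on_def refl_on_def)

lemma le_antisym: "x \<preceq> y \<Longrightarrow> y \<preceq> x \<Longrightarrow> x = y"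
  using partial_order by (auto simp: partial_order_on_def dest: antisymD)

lemma cmpl_closed: "x \<in> carrier P \<Longrightarrow> cmpl P x \<in> carrier P"
  using cmpl_fun by (auto simp: PiE_iff)

text \<open>The complement of 1 lies below both 1 and itself, and 0 is the only common lower bound
  of an element and its complement.\<close>

lemma cmpl_one: "cmpl P \<one> = \<zero>"
proof -
  have "cmpl P \<one> \<in> lower P {\<one>, cmpl P \<one>}"
    by (simp add: lower_def cmpl_closed one_closed one_greatest le_refl)
  then show ?thesis
    using lower_cmpl[OF one_closed] by simp
qed

lemma maximals_lower_pair_eq_iff:
  assumes "x \<in> carrier P" "y \<in> carrier P"
  shows "maximals P (lower P {x, y}) = {x} \<longleftrightarrow> x \<preceq> y"
proof
  assume "maximals P (lower P {x, y}) = {x}"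
  then have "x \<in> maximals P (lower P {x, y})" by simp
  then show "x \<preceq> y" by (simp add: maximals_def lower_def)
next
  assume "x \<preceq> y"
  then show "maximals P (lower P {x, y}) = {x}"
    using assms le_refl le_antisym by (auto simp: maximals_def lower_def)
qed

lemma minimals_upper_pair_eq:
  assumes "x \<in> carrier P" "y \<in> carrier P" "y \<preceq> x"
  shows "minimals P (upper P {y, x}) = {x}"
  using assms le_refl le_antisym by (auto simp: minimals_def upper_def)

text \<open>The left-hand side is x + 1 in \<open>\<bbbD> P\<close>. Both inner pairs are
  comparable, so each inner set is a singleton.\<close>

lemma symmetric_difference_one:
  assumes "x \<in> carrier P"
  shows "minimals P (upper P
    (maximals P (lower P {cmpl P x, \<one>}) \<union> maximals P (lower P {x, cmpl P \<one>}))) = {cmpl P x}"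
proof -
  have "maximals P (lower P {cmpl P x, \<one>}) = {cmpl P x}"
    using assms by (simp add: maximals_lower_pair_eq_iff cmpl_closed one_closed one_greatest)
  moreover have "maximals P (lower P {x, cmpl P \<one>}) = {\<zero>}"
    \<comment> \<open>Here 1' = 0, and 0 is the smaller member of the pair.\<close>
    using assms maximals_lower_pair_eq_iff[OF zero_closed assms]
    by (simp add: cmpl_one insert_commute zero_least)
  ultimately show ?thesis
    using assms
    by (simp add: minimals_upper_pair_eq insert_commute cmpl_closed zero_closed zero_least)
qed

end

lemma poset_of_dual_of:
  fixes P :: "'a poset_struct"
  assumes "complemented_poset P"
  shows "\<bbbB> (\<bbbD> P) = P"
proof -
  interpret complemented_poset P by fact
  have mult: "mult (\<bbbD> P) {x} {y} = maximals P (lower P {x, y})"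
    if "x \<in> carrier P" "y \<in> carrier P" for x y
    using that by (simp add: dual_of_def insert_commute)
  have add: "add (\<bbbD> P) {x} {one P} = {cmpl P x}" if "x \<in> carrier P" for x
    using that symmetric_difference_one[OF that] one_closed
    by (simp add: dual_of_def insert_commute)
  have "ord (\<bbbB> (\<bbbD> P)) = {(x, y). x \<in> carrier P \<and> y \<in> carrier P \<and> mult (\<bbbD> P) {x} {y} = {x}}"
    by (simp add: poset_of_def dual_of_def)
  also have "\<dots> = {(x, y). x \<in> carrier P \<and> y \<in> carrier P \<and> (x, y) \<in> ord P}"
    by (simp add: mult maximals_lower_pair_eq_iff cong: conj_cong)
  \<comment> \<open>Related elements lie in the carrier, so restricting to it loses nothing.\<close>
  also have "\<dots> = ord P"
    using le_carrier by auto
  finally have ord: "ord (\<bbbB> (\<bbbD> P)) = ord P" .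
  have "cmpl (\<bbbB> (\<bbbD> P)) = (\<lambda>x \<in> carrier P. the_elem (add (\<bbbD> P) {x} {one P}))"
    by (simp add: poset_of_def dual_of_def)
  also have "\<dots> = restrict (cmpl P) (carrier P)"
    by (rule restrict_ext) (simp add: add)
  \<comment> \<open>The complement is extensional, so agreement on the carrier gives equality of
    functions.\<close>
  also have "\<dots> = cmpl P"
    using cmpl_fun by (rule PiE_restrict)
  finally have cmpl: "cmpl (\<bbbB> (\<bbbD> P)) = cmpl P" .
  have "carrier (\<bbbB> (\<bbbD> P)) = carrier P" "zero (\<bbbB> (\<bbbD> P)) = zero P" "one (\<bbbB> (\<bbbD> P)) = one P"
    by (simp_all add: poset_of_def dual_of_def)
  with ord cmpl show ?thesis by simp
qed

lemma (in boolean_dual) mult_closed: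
  "A \<subseteq> carrier D \<Longrightarrow> B \<subseteq> carrier D \<Longrightarrow> A \<odot> B \<subseteq> carrier D"
  using mult_fun by (auto simp: PiE_iff Pi_iff)

text \<open>The two conjuncts of \<open>mem_mult_iff\<close> are membership in the lower bounds and
  maximality there, for the order of \<open>\<bbbB> D\<close>.\<close>

lemma maximals_lower_poset_of:
  fixes D :: "'a dual_struct"
  assumes "boolean_dual D" "A \<subseteq> carrier D" "B \<subseteq> carrier D"
  shows "maximals (\<bbbB> D) (lower (\<bbbB> D) (A \<union> B)) = A \<odot>\<^bsub>D\<^esub> B"
proof -
  interpret boolean_dual D by fact
  have "x \<in> maximals (\<bbbB> D) (lower (\<bbbB> D) (A \<union> B)) \<longleftrightarrow> x \<in> A \<odot>\<^bsub>D\<^esub> B"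
    if "x \<in> carrier D" for x
    unfolding mem_mult_iff[OF assms(2,3) that]
    using that assms(2,3) by (auto simp: maximals_def lower_def poset_of_def)
  \<comment> \<open>\<open>mem_mult_iff\<close> speaks only of carrier elements, so both sides must
    be confined to the carrier.\<close>
  moreover have "maximals (\<bbbB> D) (lower (\<bbbB> D) (A \<union> B)) \<subseteq> carrier D"
    by (auto simp: maximals_def lower_def poset_of_def)
  ultimately show ?thesis
    using mult_closed[OF assms(2,3)] by blast
qed

lemma mult_dual_of_poset_of:
  fixes D :: "'a dual_struct"
  assumes "boolean_dual D"
  shows "mult (\<bbbD> (\<bbbB> D)) = mult D"
proof -
  interpret boolean_dual D by fact
  have "mult (\<bbbD> (\<bbbB> D)) = (\<lambda>A \<in> Pow (carrier D). \<lambda>B \<in> Pow (carrier D).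
      maximals (\<bbbB> D) (lower (\<bbbB> D) (A \<union> B)))"
    by (simp add: dual_of_def, simp add: poset_of_def)
  also have "\<dots> = (\<lambda>A \<in> Pow (carrier D). \<lambda>B \<in> Pow (carrier D). A \<odot>\<^bsub>D\<^esub> B)"
    by (intro restrict_ext) (simp add: maximals_lower_poset_of assms)
  \<comment> \<open>Extensionality of \<open>mult D\<close> removes the restriction in the second
    argument here, and in the first argument next.\<close>
  also have "\<dots> = (\<lambda>A \<in> Pow (carrier D). mult D A)"
    using mult_fun by (intro restrict_ext PiE_restrict) (auto simp: PiE_iff)
  also have "\<dots> = mult D"
    using mult_fun by (rule PiE_restrict)
  finally show ?thesis .
qed

theorem theorem5p4:
  shows "(\<forall>P :: 'a poset_struct. boolean_poset P \<and> finite (carrier P) \<longrightarrow> \<bbbB> (\<bbbD> P) = P) \<and>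
    (\<forall>D :: 'a dual_struct. boolean_dual D \<and> finite (carrier D) \<longrightarrow>
      (\<forall>A B. A \<subseteq> carrier D \<and> B \<subseteq> carrier D \<longrightarrow> A \<odot>\<^bsub>\<bbbD> (\<bbbB> D)\<^esub> B = A \<odot>\<^bsub>D\<^esub> B) \<and>
      (carrier (\<bbbD> (\<bbbB> D)), mult (\<bbbD> (\<bbbB> D)), zero (\<bbbD> (\<bbbB> D)), one (\<bbbD> (\<bbbB> D))) =
      (carrier D, mult D, zero D, one D))"
proof (intro conjI allI impI; elim conjE)
  fix P :: "'a poset_struct"
  assume "boolean_poset P"
  then show "\<bbbB> (\<bbbD> P) = P"
    by (simp add: boolean_poset.axioms poset_of_dual_of)
next
  fix D :: "'a dual_struct" and A B
  assume "boolean_dual D"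
  then show "A \<odot>\<^bsub>\<bbbD> (\<bbbB> D)\<^esub> B = A \<odot>\<^bsub>D\<^esub> B"
    by (simp add: mult_dual_of_poset_of)
next
  fix D :: "'a dual_struct"
  assume "boolean_dual D"
  then show "(carrier (\<bbbD> (\<bbbB> D)), mult (\<bbbD> (\<bbbB> D)), zero (\<bbbD> (\<bbbB> D)), one (\<bbbD> (\<bbbB> D))) =
      (carrier D, mult D, zero D, one D)"
    by (simp add: mult_dual_of_poset_of) (simp add: dual_of_def poset_of_def)
qed

end
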